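(* The following conditions are equivalent: (1) there exists an $A$-filter on $\omega$ which has no countable base; (2) there exists a nonmetrizable $\mathbb R^{\omega_1}$-factorizable space; (3) there exists a nonmetrizable $\mathbb R^{\omega_1}$-factorizable topological group.
   Context: All topological spaces (including those underlying topological groups) are assumed to be Tychonoff. A space $X$ is $\mathbb R^{\omega_1}$-factorizable if for every continuous function $f\colon X\to\mathbb R^{\omega_1}$ there exist a second-countable space $Y$ and continuous functions $h\colon X\to Y$ and $g\colon Y\to\mathbb R^{\omega_1}$ such that $f=g\circ h$. A topological group is called $\mathbb R^{\omega_1}$-factorizable if its underlying topological space is. A filter $\mathscr F$ on a set is an $A$-filter if, given any $F_\alpha\in\mathscr F$, $\alpha<\omega_1$, there exist $G_n\in\mathscr F$, $n<\omega$, such that each $F_\alpha$ contains $G_{n_\alpha}$ for some $n_\alpha<\omega$. A base of $\mathscr F$ is a subfamily $\mathscr B\subset\mathscr F$ such that every element of $\mathscr F$ contains an element of $\mathscr B$. *)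

theory Defs
  imports "HOL-Analysis.Analysis" "HOL-Algebra.Group"
begin

definition Tychonoff_space :: "'a topology \<Rightarrow> bool" where
  "Tychonoff_space X \<longleftrightarrow> completely_regular_space X \<and> Hausdorff_space X"

text \<open>The library's well-order of type \<open>\<omega>\<^sub>1\<close> is \<^term>\<open>cardSuc natLeq\<close>; its field, a set of elements of
  type \<^typ>\<open>nat set\<close>, serves as the index set \<open>{\<alpha>. \<alpha> < \<omega>\<^sub>1}\<close>. Consequently \<open>powertop_real omega1\<close> is
  the product space of \<open>\<omega>\<^sub>1\<close> real lines.\<close>

definition omega1 :: "nat set set" where
  "omega1 = Field (cardSuc natLeq)"

text \<open>HOL cannot quantify over types inside a formula, so the carrier of the intermediate space
  \<open>Y\<close> is taken inside the fixed type \<^typ>\<open>nat set\<close>. This loses no space: the lemma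
  \<open>second_countable_homeomorphic_nat_set\<close> below shows that every second-countable Hausdorff space,
  over any type, is homeomorphic to one of this form.\<close>

definition R_omega1_factorizable :: "'a topology \<Rightarrow> bool" where
  "R_omega1_factorizable X \<longleftrightarrow>
    (\<forall>f. continuous_map X (powertop_real omega1) f \<longrightarrow>
      (\<exists>(Y :: nat set topology) h g.
         Tychonoff_space Y \<and> second_countable Y \<and>
         continuous_map X Y h \<and> continuous_map Y (powertop_real omega1) g \<and>
         (\<forall>x\<in>topspace X. f x = g (h x))))"

definition topological_group :: "('a, 'm) monoid_scheme \<Rightarrow> 'a topology \<Rightarrow> bool" where
  "topological_group G T \<longleftrightarrow>
    group G \<and> topspace T = carrier G \<and>
    continuous_map (prod_topology T T) T (\<lambda>(x, y). x \<otimes>\<^bsub>G\<^esub> y) \<and>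
    continuous_map T T (\<lambda>x. inv\<^bsub>G\<^esub> x)"

text \<open>A filter in the usual sense is a library filter different from \<^term>\<open>bot\<close>; its
  elements are the sets in the following family.\<close>

definition filter_sets :: "'a filter \<Rightarrow> 'a set set" where
  "filter_sets F = {A. eventually (\<lambda>x. x \<in> A) F}"

definition A_filter :: "'a filter \<Rightarrow> bool" where
  "A_filter F \<longleftrightarrow> F \<noteq> bot \<and>
    (\<forall>\<Phi>. (\<forall>\<alpha>\<in>omega1. \<Phi> \<alpha> \<in> filter_sets F) \<longrightarrow>
      (\<exists>\<Gamma> :: nat \<Rightarrow> 'a set. (\<forall>n. \<Gamma> n \<in> filter_sets F) \<and> (\<forall>\<alpha>\<in>omega1. \<exists>n. \<Gamma> n \<subseteq> \<Phi> \<alpha>)))"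

definition filter_base :: "'a filter \<Rightarrow> 'a set set \<Rightarrow> bool" where
  "filter_base F \<B> \<longleftrightarrow> \<B> \<subseteq> filter_sets F \<and> (\<forall>A\<in>filter_sets F. \<exists>B\<in>\<B>. B \<subseteq> A)"

lemma second_countable_homeomorphic_nat_set:
  assumes "second_countable Y" and "Hausdorff_space Y"
  obtains Z :: "nat set topology" where "Y homeomorphic_space Z"
proof -
  obtain \<B> where cB: "countable \<B>"
    and B: "\<forall>U x. openin Y U \<and> x \<in> U \<longrightarrow> (\<exists>V\<in>\<B>. x \<in> V \<and> V \<subseteq> U)"
    using assms(1) unfolding second_countable_def by (elim exE conjE) (rule that)
  define e where "e = (\<lambda>x. {n. x \<in> from_nat_into \<B> n})"
  define d where "d = inv_into (topspace Y) e"
  define Z where "Z = pullback_topology (e ` topspace Y) d Y"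
  have inj: "inj_on e (topspace Y)"
  proof (rule inj_onI, rule ccontr)
    fix x y assume xy: "x \<in> topspace Y" "y \<in> topspace Y" "e x = e y" "x \<noteq> y"
    have "\<exists>U V. openin Y U \<and> openin Y V \<and> x \<in> U \<and> y \<in> V \<and> disjnt U V"
      using assms(2) xy(1,2,4) unfolding Hausdorff_space_def by simp
    then obtain U V where U: "openin Y U" "x \<in> U" "y \<in> V" "disjnt U V"
      by (elim exE conjE) (rule that)
    obtain W where W: "W \<in> \<B>" "x \<in> W" "W \<subseteq> U"
      using B[rule_format, OF conjI, OF U(1,2)] by (elim bexE conjE) (rule that)
    obtain n where "from_nat_into \<B> n = W"
      using from_nat_into_surj[OF cB W(1)] by (elim exE) (rule that)
    then have "n \<in> e x" using W(2) by (simp add: e_def)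
    then have "n \<in> e y" by (simp only: xy(3))
    then have "y \<in> W" using \<open>from_nat_into \<B> n = W\<close> by (simp add: e_def)
    then show False using U(3,4) W(3) by (auto simp: disjnt_iff)
  qed
  have de: "d (e x) = x" if "x \<in> topspace Y" for x
    unfolding d_def using inj that by (rule inv_into_f_f)
  have tZ: "topspace Z = e ` topspace Y"
    unfolding Z_def topspace_pullback_topology by (auto simp: de)
  have "continuous_map Y Z e"
    unfolding Z_def
  proof (rule continuous_map_pullback')
    show "continuous_map Y Y (d \<circ> e)"
      by (rule continuous_map_eq[OF continuous_map_id]) (simp add: de)
  qed auto
  moreover have "continuous_map Z Y d"
    using continuous_map_pullback[OF continuous_map_id, of "e ` topspace Y" d Y]
    by (simp only: Z_def id_comp)
  ultimately have "homeomorphic_maps Y Z e d"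
    unfolding homeomorphic_maps_def by (auto simp: de tZ)
  then show thesis
    by (intro that[of Z]) (auto simp: homeomorphic_space_def)
qed

end

theory Submission
  imports Defs "HOL-Library.Countable_Set_Type"
begin

text \<open>
The link between the three conditions is that a factorization through a second-countable space
compresses \<open>\<omega>\<^sub>1\<close> many neighbourhoods to countably many, which is what an \<open>A\<close>-filter does with its
elements.

From spaces to filters: let \<open>X\<close> be \<open>\<real>\<^sup>\<omega>\<^sup>1\<close>-factorizable. Given \<open>\<omega>\<^sub>1\<close> many points \<open>p\<^sub>\<alpha>\<close> with open
neighbourhoods \<open>U\<^sub>\<alpha>\<close>, join functions separating \<open>p\<^sub>\<alpha>\<close> from the complement of \<open>U\<^sub>\<alpha>\<close> into one map to
\<open>\<real>\<^sup>\<omega>\<^sup>1\<close> and pull back a countable base of the factor: the result is a countable family of open sets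
containing, for each \<open>\<alpha>\<close>, some \<open>W\<close> with \<open>p\<^sub>\<alpha> \<in> W \<subseteq> U\<^sub>\<alpha>\<close>
(\<open>R_omega1_factorizable_countable_refinement\<close>). This refinement property excludes left-separated
\<open>\<omega>\<^sub>1\<close>-sequences, so \<open>X\<close> is separable, and by a transfinite construction it makes \<open>X\<close> second
countable as soon as it is first countable. Hence a nonmetrizable \<open>X\<close> has a point \<open>a\<close> of
uncountable character. The trace of the neighbourhoods of \<open>a\<close> on a dense sequence is a filter on
\<open>\<omega>\<close>; it is an \<open>A\<close>-filter by the refinement property, and by regularity and density a countable base
of it would give a countable local base at \<open>a\<close>.

From filters to groups: let \<open>F\<close> be an \<open>A\<close>-filter without a countable base and \<open>K = \<Inter>F\<close>. The finite
subsets of \<open>\<omega> - K\<close> form a countable Boolean group under symmetric difference, and the subgroups of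
finite subsets of \<open>A - K\<close>, for \<open>A \<in> F\<close>, are a base at the neutral element of a Hausdorff group
topology. A countable base there would yield one of \<open>F\<close>, so the group is not metrizable. Given \<open>\<omega>\<^sub>1\<close>
many continuous real functions, the \<open>A\<close>-property at each of the countably many points and for each
precision \<open>1 / (k + 1)\<close> yields a countable subfamily of \<open>F\<close> which witnesses the continuity of all of
them. The topology built in the same way from that subfamily is second countable, and the functions
factor through it. A countable group embeds into every infinite type, so the same construction
serves for both carrier types in the theorem.
\<close>

section \<open>The ordinal \<open>\<omega>\<^sub>1\<close>\<close>

abbreviation preds :: "nat set \<Rightarrow> nat set set" where
  "preds \<equiv> underS (cardSuc natLeq)"

lemma wo_rel_omega1: "wo_rel (cardSuc natLeq)"
  by (simp add: wo_rel_def card_order_on_well_order_on cardSuc_Card_order natLeq_Card_order)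

lemma countable_preds:
  assumes "\<gamma> \<in> omega1"
  shows "countable (preds \<gamma>)"
proof -
  include cardinal_syntax
  have "|preds \<gamma>| <o cardSuc natLeq"
    using assms by (intro card_of_underS cardSuc_Card_order natLeq_Card_order) (simp add: omega1_def)
  then show ?thesis
    by (simp add: countable_card_le_natLeq cardSuc_ordLeq_ordLess natLeq_Card_order card_of_Card_order)
qed

lemma uncountable_omega1: "uncountable omega1"
proof
  include cardinal_syntax
  assume "countable omega1"
  then have "|omega1| \<le>o natLeq" by (simp add: countable_card_le_natLeq)
  then have "cardSuc natLeq \<le>o natLeq"
    unfolding omega1_def
    by (meson card_of_Field_ordIso cardSuc_Card_order natLeq_Card_order ordIso_symmetric ordIso_ordLeq_trans)
  then show False
    using cardSuc_greater[OF natLeq_Card_order] not_ordLess_ordLeq by blast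
qed

lemma countable_subset_omega1_bounded:
  assumes "countable C" "C \<subseteq> omega1"
  obtains \<gamma> where "\<gamma> \<in> omega1" "C \<subseteq> preds \<gamma>"
proof -
  have "countable (\<Union>c\<in>C. insert c (preds c))"
    using assms countable_preds by (intro countable_UN) auto
  then have "\<not> omega1 \<subseteq> (\<Union>c\<in>C. insert c (preds c))"
    using uncountable_omega1 countable_subset by blast
  then obtain \<gamma> where \<gamma>: "\<gamma> \<in> omega1" "\<And>c. c \<in> C \<Longrightarrow> \<gamma> \<noteq> c \<and> \<gamma> \<notin> preds c" by blast
  have "c \<in> preds \<gamma>" if "c \<in> C" for c
    using wo_rel.TOTALS[OF wo_rel_omega1] \<gamma> that assms(2)
    unfolding omega1_def underS_def by blast
  then show thesis using \<gamma>(1) that by blast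
qed

lemma preds_cases:
  assumes "\<alpha> \<in> omega1" "\<beta> \<in> omega1" "\<alpha> \<noteq> \<beta>"
  shows "\<alpha> \<in> preds \<beta> \<or> \<beta> \<in> preds \<alpha>"
  using wo_rel.TOTALS[OF wo_rel_omega1] assms unfolding omega1_def underS_def by blast

text \<open>A property that can be met over every countable set can be met along \<open>\<omega>\<^sub>1\<close>, because the values chosen
before any given stage are only countably many.\<close>

lemma omega1_recursion:
  assumes "\<And>S. countable S \<Longrightarrow> \<exists>x. P S x"
  obtains x :: "nat set \<Rightarrow> 'a" where "\<And>\<gamma>. \<gamma> \<in> omega1 \<Longrightarrow> P (x ` preds \<gamma>) (x \<gamma>)"
proof -
  define H where "H = (\<lambda>x \<gamma>. SOME y. P (x ` preds \<gamma>) y)"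
  define x where "x = wo_rel.worec (cardSuc natLeq) H"
  have "wo_rel.adm_wo (cardSuc natLeq) H"
    unfolding wo_rel.adm_wo_def[OF wo_rel_omega1] H_def by (simp cong: image_cong_simp)
  then have "x = H x"
    unfolding x_def by (rule wo_rel.worec_fixpoint[OF wo_rel_omega1])
  then have eq: "x \<gamma> = (SOME y. P (x ` preds \<gamma>) y)" for \<gamma>
    unfolding H_def by (rule fun_cong)
  have "P (x ` preds \<gamma>) (x \<gamma>)" if "\<gamma> \<in> omega1" for \<gamma>
    unfolding eq[of \<gamma>]
    by (rule someI_ex[OF assms[OF countable_image[OF countable_preds[OF that]]]])
  then show thesis using that by blast
qed

section \<open>Properties of factorizable spaces\<close>

text \<open>This consequence of factorizability is the only one used below. The Tychonoff property provides a function
vanishing at \<open>p \<alpha>\<close> and equal to \<open>1\<close> off \<open>U \<alpha>\<close>; after factorization, the condition that it be below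
\<open>1\<close> is open in the second-countable factor.\<close>

lemma R_omega1_factorizable_countable_refinement:
  fixes X :: "'a topology"
  assumes ty: "Tychonoff_space X" and fa: "R_omega1_factorizable X"
    and U: "\<And>\<alpha>. \<alpha> \<in> omega1 \<Longrightarrow> openin X (U \<alpha>) \<and> p \<alpha> \<in> U \<alpha>"
  shows "\<exists>\<W>. countable \<W> \<and> (\<forall>W\<in>\<W>. openin X W) \<and> (\<forall>\<alpha>\<in>omega1. \<exists>W\<in>\<W>. p \<alpha> \<in> W \<and> W \<subseteq> U \<alpha>)"
proof -
  have "\<exists>\<phi>. continuous_map X euclideanreal \<phi> \<and> \<phi> (p \<alpha>) = 0 \<and> \<phi> ` (topspace X - U \<alpha>) \<subseteq> {1}"
    if "\<alpha> \<in> omega1" for \<alpha>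
  proof -
    have "closedin X (topspace X - U \<alpha>)" "p \<alpha> \<in> topspace X - (topspace X - U \<alpha>)"
      using U[OF that] openin_subset by auto
    then show ?thesis
      using ty unfolding Tychonoff_space_def completely_regular_space_alt by blast
  qed
  then obtain \<phi> where \<phi>: "\<And>\<alpha>. \<alpha> \<in> omega1 \<Longrightarrow> continuous_map X euclideanreal (\<phi> \<alpha>)"
    "\<And>\<alpha>. \<alpha> \<in> omega1 \<Longrightarrow> \<phi> \<alpha> (p \<alpha>) = 0"
    "\<And>\<alpha>. \<alpha> \<in> omega1 \<Longrightarrow> \<phi> \<alpha> ` (topspace X - U \<alpha>) \<subseteq> {1}"
    by metis
  define f where "f = (\<lambda>x. \<lambda>\<alpha>\<in>omega1. \<phi> \<alpha> x)"
  have "continuous_map X (powertop_real omega1) f"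
    unfolding continuous_map_componentwise f_def using \<phi>(1) by auto
  then obtain Y :: "nat set topology" and h g where Y: "second_countable Y" "continuous_map X Y h"
      "continuous_map Y (powertop_real omega1) g" "\<And>x. x \<in> topspace X \<Longrightarrow> f x = g (h x)"
    using fa unfolding R_omega1_factorizable_def by metis
  obtain \<B> where \<B>: "countable \<B>" "\<And>B. B \<in> \<B> \<Longrightarrow> openin Y B"
      "\<And>V x. openin Y V \<Longrightarrow> x \<in> V \<Longrightarrow> \<exists>B\<in>\<B>. x \<in> B \<and> B \<subseteq> V"
    using Y(1) unfolding second_countable_def by metis
  define pre where "pre = (\<lambda>B. {x \<in> topspace X. h x \<in> B})"
  show ?thesis
  proof (intro exI[of _ "pre ` \<B>"] conjI ballI)
    show "countable (pre ` \<B>)" using \<B>(1) by simp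
    show "openin X W" if "W \<in> pre ` \<B>" for W
      using that \<B>(2) Y(2) unfolding pre_def continuous_map_def by auto
    show "\<exists>W\<in>pre ` \<B>. p \<alpha> \<in> W \<and> W \<subseteq> U \<alpha>" if \<alpha>: "\<alpha> \<in> omega1" for \<alpha>
    proof -
      have pX: "p \<alpha> \<in> topspace X" using U[OF \<alpha>] openin_subset by blast
      have "continuous_map Y euclideanreal (\<lambda>y. g y \<alpha>)"
        using Y(3) \<alpha> unfolding continuous_map_componentwise by blast
      then have "openin Y {y \<in> topspace Y. g y \<alpha> \<in> {..<1}}"
        by (rule openin_continuous_map_preimage) simp
      moreover have "h (p \<alpha>) \<in> {y \<in> topspace Y. g y \<alpha> \<in> {..<1}}"
        using pX Y(2) Y(4)[OF pX, symmetric] \<phi>(2)[OF \<alpha>] \<alpha>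
        by (auto simp: f_def continuous_map_def)
      ultimately obtain B where B: "B \<in> \<B>" "h (p \<alpha>) \<in> B" "B \<subseteq> {y \<in> topspace Y. g y \<alpha> \<in> {..<1}}"
        using \<B>(3) by meson
      have "pre B \<subseteq> U \<alpha>"
      proof
        fix x assume "x \<in> pre B"
        then have x: "x \<in> topspace X" "g (h x) \<alpha> < 1" using B(3) by (auto simp: pre_def)
        then have "\<phi> \<alpha> x < 1" using Y(4)[OF x(1), symmetric] \<alpha> by (simp add: f_def)
        then show "x \<in> U \<alpha>" using \<phi>(3)[OF \<alpha>] x(1) by force
      qed
      then show ?thesis using B pX by (auto simp: pre_def)
    qed
  qed
qed

text \<open>Otherwise some \<open>\<omega>\<^sub>1\<close>-sequence has each point outside the closure of its predecessors. In a countable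
refinement of the complements of these closures, distinct points would need distinct sets.\<close>

lemma R_omega1_factorizable_imp_separable_space:
  assumes ty: "Tychonoff_space X" and fa: "R_omega1_factorizable X"
  shows "separable_space X"
proof (rule ccontr)
  assume ns: "\<not> separable_space X"
  have "\<exists>x. x \<in> topspace X - X closure_of S" if "countable S" for S
  proof (rule ccontr)
    assume "\<nexists>x. x \<in> topspace X - X closure_of S"
    then have "X closure_of (topspace X \<inter> S) = topspace X"
      using closure_of_subset_topspace closure_of_restrict by (metis Diff_iff subsetI subset_antisym)
    then show False
      using ns that unfolding separable_space_def by blast
  qed
  then obtain x where x: "\<And>\<gamma>. \<gamma> \<in> omega1 \<Longrightarrow> x \<gamma> \<in> topspace X - X closure_of (x ` preds \<gamma>)"
    by (rule omega1_recursion[of "\<lambda>S y. y \<in> topspace X - X closure_of S"]) auto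
  define U where "U = (\<lambda>\<gamma>. topspace X - X closure_of (x ` preds \<gamma>))"
  have "openin X (U \<gamma>) \<and> x \<gamma> \<in> U \<gamma>" if "\<gamma> \<in> omega1" for \<gamma>
    using x[OF that] by (auto simp: U_def)
  then obtain \<W> where \<W>: "countable \<W>" "\<forall>\<gamma>\<in>omega1. \<exists>W\<in>\<W>. x \<gamma> \<in> W \<and> W \<subseteq> U \<gamma>"
    using R_omega1_factorizable_countable_refinement[OF ty fa, of U x] by blast
  have "\<exists>w. \<forall>\<gamma>\<in>omega1. w \<gamma> \<in> \<W> \<and> x \<gamma> \<in> w \<gamma> \<and> w \<gamma> \<subseteq> U \<gamma>"
    using \<W>(2) by (intro bchoice) blast
  then obtain w where w: "\<And>\<gamma>. \<gamma> \<in> omega1 \<Longrightarrow> w \<gamma> \<in> \<W> \<and> x \<gamma> \<in> w \<gamma> \<and> w \<gamma> \<subseteq> U \<gamma>"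
    by blast
  have notin: "x \<beta> \<notin> U \<gamma>" if "\<gamma> \<in> omega1" "\<beta> \<in> omega1" "\<beta> \<in> preds \<gamma>" for \<beta> \<gamma>
  proof -
    have "x \<beta> \<in> topspace X \<inter> x ` preds \<gamma>" using x[OF that(2)] that(3) by blast
    then have "x \<beta> \<in> X closure_of (x ` preds \<gamma>)"
      by (rule subsetD[OF closure_of_subset_Int])
    then show ?thesis by (simp add: U_def)
  qed
  have ne: "w \<beta> \<noteq> w \<gamma>" if "\<gamma> \<in> omega1" "\<beta> \<in> omega1" "\<beta> \<in> preds \<gamma>" for \<beta> \<gamma>
    using notin[OF that] w[OF that(1)] w[OF that(2)] by auto
  have "inj_on w omega1"
  proof (rule inj_onI, rule ccontr)
    fix \<beta> \<gamma> assume *: "\<beta> \<in> omega1" "\<gamma> \<in> omega1" "w \<beta> = w \<gamma>" "\<beta> \<noteq> \<gamma>"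
    show False
      using preds_cases[OF *(1,2,4)] ne[OF *(2,1)] ne[OF *(1,2)] *(3) by auto
  qed
  moreover have "countable (w ` omega1)"
    using \<W>(1) w by (auto intro!: countable_subset[OF _ \<W>(1)])
  ultimately show False
    using uncountable_omega1 by (metis countable_image_inj_on)
qed

text \<open>Suppose that \<open>X\<close> is first countable but not second countable, and fix local bases \<open>b x\<close>. Points
\<open>x \<gamma>\<close> are chosen so that the sets \<open>b (x \<beta>) n\<close> with \<open>\<beta> < \<gamma>\<close>, a countable family, contain no local base at
\<open>x \<gamma>\<close>. On the other hand, a countable family \<open>\<W>\<close> contains local bases at all points \<open>x \<alpha>\<close> at once.
For \<open>V, W \<in> \<W>\<close> with \<open>V \<subseteq> b (x \<beta>) n \<subseteq> W\<close> for some \<open>\<beta>\<close> and \<open>n\<close>, pick one such \<open>\<beta>\<close>. The indices picked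
are countably many, so some \<open>\<gamma>\<close> exceeds them all; but then they supply a local base at \<open>x \<gamma>\<close>.\<close>

lemma R_omega1_factorizable_first_countable_imp_second_countable:
  assumes ty: "Tychonoff_space X" and fa: "R_omega1_factorizable X" and fc: "first_countable X"
  shows "second_countable X"
proof (rule ccontr)
  assume nsc: "\<not> second_countable X"
  have "\<exists>b :: nat \<Rightarrow> 'a set. (\<forall>n. openin X (b n) \<and> x \<in> b n) \<and> (\<forall>U. openin X U \<longrightarrow> x \<in> U \<longrightarrow> (\<exists>n. b n \<subseteq> U))"
    if x: "x \<in> topspace X" for x
  proof -
    obtain \<B> where \<B>: "countable \<B>" "\<And>V. V \<in> \<B> \<Longrightarrow> openin X V"
      "\<And>U. openin X U \<Longrightarrow> x \<in> U \<Longrightarrow> \<exists>V\<in>\<B>. x \<in> V \<and> V \<subseteq> U"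
      using fc x unfolding first_countable_def by metis
    define \<C> where "\<C> = {V \<in> \<B>. x \<in> V}"
    have \<C>: "countable \<C>" "\<C> \<noteq> {}"
      using \<B>(1) \<B>(3)[OF openin_topspace x] by (auto simp: \<C>_def)
    have "range (from_nat_into \<C>) = \<C>" by (rule range_from_nat_into[OF \<C>(2,1)])
    then have "openin X (from_nat_into \<C> n) \<and> x \<in> from_nat_into \<C> n" for n
      using \<B>(2) unfolding \<C>_def by blast
    moreover have "\<exists>n. from_nat_into \<C> n \<subseteq> U" if U: "openin X U" "x \<in> U" for U
    proof -
      obtain V where "V \<in> \<C>" "V \<subseteq> U" using \<B>(3)[OF U] unfolding \<C>_def by blast
      then show ?thesis using \<open>range (from_nat_into \<C>) = \<C>\<close> by (metis rangeE)
    qed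
    ultimately show ?thesis by blast
  qed
  then have "\<exists>b. \<forall>x\<in>topspace X. (\<forall>n :: nat. openin X (b x n) \<and> x \<in> b x n) \<and>
      (\<forall>U. openin X U \<longrightarrow> x \<in> U \<longrightarrow> (\<exists>n. b x n \<subseteq> U))"
    by (intro bchoice) blast
  then obtain b :: "'a \<Rightarrow> nat \<Rightarrow> 'a set" where b: "\<And>x n. x \<in> topspace X \<Longrightarrow> openin X (b x n) \<and> x \<in> b x n"
    "\<And>x U. openin X U \<Longrightarrow> x \<in> U \<Longrightarrow> \<exists>n. b x n \<subseteq> U"
    using openin_subset by (metis subsetD)
  \<comment> \<open>\<open>P S x\<close>: the local bases at the points of \<open>S\<close> do not contain a local base at \<open>x\<close>, as \<open>U\<close> witnesses.\<close>
  define P where "P = (\<lambda>S x. x \<in> topspace X \<and> (\<exists>U. openin X U \<and> x \<in> U \<and>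
      (\<forall>s\<in>S. s \<in> topspace X \<longrightarrow> (\<forall>n. x \<in> b s n \<longrightarrow> \<not> b s n \<subseteq> U))))"
  have "\<exists>x. P S x" if "countable S" for S
  proof (rule ccontr)
    assume np: "\<nexists>x. P S x"
    define \<B> where "\<B> = (\<Union>s\<in>S \<inter> topspace X. range (b s))"
    have "countable \<B>" using that by (auto simp: \<B>_def)
    moreover have "\<forall>V\<in>\<B>. openin X V" using b(1) by (auto simp: \<B>_def)
    moreover have "\<exists>V\<in>\<B>. x \<in> V \<and> V \<subseteq> U" if U: "openin X U" "x \<in> U" for U x
    proof -
      have "x \<in> topspace X" using U openin_subset by blast
      then obtain s n where "s \<in> S" "s \<in> topspace X" "x \<in> b s n" "b s n \<subseteq> U"
        using np U unfolding P_def by blast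
      then show ?thesis by (auto simp: \<B>_def)
    qed
    ultimately have "second_countable X"
      unfolding second_countable_def by (intro exI[of _ \<B>] conjI allI impI) simp_all
    then show False using nsc by simp
  qed
  then obtain x where x: "\<And>\<gamma>. \<gamma> \<in> omega1 \<Longrightarrow> P (x ` preds \<gamma>) (x \<gamma>)"
    by (rule omega1_recursion[of P]) auto
  then have xX: "x \<gamma> \<in> topspace X" if "\<gamma> \<in> omega1" for \<gamma>
    using that by (auto simp: P_def)
  have "\<exists>\<W>. countable \<W> \<and> (\<forall>W\<in>\<W>. openin X W) \<and> (\<forall>\<alpha>\<in>omega1. \<exists>W\<in>\<W>. x \<alpha> \<in> W \<and> W \<subseteq> b (x \<alpha>) n)" for n
  proof -
    have "openin X (b (x \<alpha>) n) \<and> x \<alpha> \<in> b (x \<alpha>) n" if "\<alpha> \<in> omega1" for \<alpha>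
      using xX[OF that] b(1) by blast
    from R_omega1_factorizable_countable_refinement[OF ty fa this] show ?thesis .
  qed
  then obtain \<W>' where \<W>': "\<And>n. countable (\<W>' n)" "\<And>n W. W \<in> \<W>' n \<Longrightarrow> openin X W"
    "\<And>n \<alpha>. \<alpha> \<in> omega1 \<Longrightarrow> \<exists>W\<in>\<W>' n. x \<alpha> \<in> W \<and> W \<subseteq> b (x \<alpha>) n"
    by metis
  define \<W> where "\<W> = (\<Union>n. \<W>' n)"
  have c\<W>: "countable \<W>" by (simp add: \<W>_def \<W>'(1))
  have \<W>: "\<exists>W\<in>\<W>. x \<alpha> \<in> W \<and> W \<subseteq> U" if *: "\<alpha> \<in> omega1" "openin X U" "x \<alpha> \<in> U" for \<alpha> U
  proof -
    obtain n where "b (x \<alpha>) n \<subseteq> U" using b(2)[OF *(2,3)] by (elim exE)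
    moreover obtain W where "W \<in> \<W>' n" "x \<alpha> \<in> W" "W \<subseteq> b (x \<alpha>) n"
      using \<W>'(3)[OF *(1)] by blast
    ultimately show ?thesis unfolding \<W>_def by blast
  qed
  \<comment> \<open>The set \<open>C\<close> collects one index \<open>\<beta>\<close> for each pair \<open>V \<subseteq> W\<close> of members of \<open>\<W>\<close> with some \<open>b (x \<beta>) n\<close> between them.\<close>
  define Q where "Q = (\<lambda>V W \<beta>. \<beta> \<in> omega1 \<and> (\<exists>n. V \<subseteq> b (x \<beta>) n \<and> b (x \<beta>) n \<subseteq> W))"
  define c where "c = (\<lambda>(V, W). SOME \<beta>. Q V W \<beta>)"
  define C where "C = c ` {(V, W) \<in> \<W> \<times> \<W>. \<exists>\<beta>. Q V W \<beta>}"
  have cQ: "Q V W (c (V, W))" if "Q V W \<beta>" for V W \<beta>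
    using someI[of "Q V W", OF that] by (simp add: c_def)
  have "countable C"
    unfolding C_def by (rule countable_image, rule countable_subset[OF _ countable_SIGMA[OF c\<W> c\<W>]]) auto
  moreover have "C \<subseteq> omega1"
  proof
    fix \<beta> assume "\<beta> \<in> C"
    then obtain V W \<beta>' where "\<beta> = c (V, W)" "Q V W \<beta>'" unfolding C_def by auto
    then have "Q V W \<beta>" using cQ by simp
    then show "\<beta> \<in> omega1" by (simp add: Q_def)
  qed
  ultimately obtain \<gamma> where \<gamma>: "\<gamma> \<in> omega1" "C \<subseteq> preds \<gamma>"
    by (rule countable_subset_omega1_bounded)
  obtain U where U: "openin X U" "x \<gamma> \<in> U"
      "\<And>\<beta> n. \<beta> \<in> preds \<gamma> \<Longrightarrow> x \<beta> \<in> topspace X \<Longrightarrow> x \<gamma> \<in> b (x \<beta>) n \<Longrightarrow> \<not> b (x \<beta>) n \<subseteq> U"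
    using x[OF \<gamma>(1)] unfolding P_def by blast
  obtain W where W: "W \<in> \<W>" "x \<gamma> \<in> W" "W \<subseteq> U" using \<W>[OF \<gamma>(1) U(1,2)] by blast
  have "openin X W" using W(1) \<W>'(2) by (auto simp: \<W>_def)
  then obtain n where n: "b (x \<gamma>) n \<subseteq> W" using b(2) W(2) by blast
  \<comment> \<open>The index \<open>\<gamma>\<close> itself qualifies for the pair \<open>V, W\<close>, hence so does an index picked below \<open>\<gamma>\<close>.\<close>
  obtain V where V: "V \<in> \<W>" "x \<gamma> \<in> V" "V \<subseteq> b (x \<gamma>) n"
    using \<W>[OF \<gamma>(1)] b(1)[OF xX[OF \<gamma>(1)]] by metis
  have "Q V W \<gamma>" using \<gamma>(1) V(3) n by (auto simp: Q_def)
  then have "Q V W (c (V, W))" and "c (V, W) \<in> C"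
    using cQ V(1) W(1) by (auto simp: C_def)
  then show False
    using U(3)[of "c (V, W)"] \<gamma>(2) V(2) W(3) xX unfolding Q_def by blast
qed

text \<open>Urysohn's metrization theorem: countably many functions, one for each suitable pair of members of a
countable base, embed the space into a countable power of the real line.\<close>

lemma Tychonoff_second_countable_imp_metrizable:
  assumes ty: "Tychonoff_space X" and sc: "second_countable X"
  shows "metrizable_space X"
proof -
  obtain \<B> where \<B>: "countable \<B>" "\<And>V. V \<in> \<B> \<Longrightarrow> openin X V"
    "\<And>U x. openin X U \<Longrightarrow> x \<in> U \<Longrightarrow> \<exists>V\<in>\<B>. x \<in> V \<and> V \<subseteq> U"
    using sc unfolding second_countable_def by metis
  define S where "S = (\<lambda>(U, V) \<phi>. continuous_map X euclideanreal \<phi> \<and>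
      (\<forall>x\<in>U. \<phi> x = 0) \<and> (\<forall>x\<in>topspace X - V. \<phi> x = 1))"
  define I where "I = {p \<in> \<B> \<times> \<B>. \<exists>\<phi>. S p \<phi>}"
  define \<phi> where "\<phi> = (\<lambda>p. SOME \<phi>. S p \<phi>)"
  have \<phi>: "S p (\<phi> p)" if "p \<in> I" for p
    using that unfolding I_def \<phi>_def by (auto intro!: someI_ex[of "S p"])
  have "countable I" unfolding I_def by (rule countable_subset[OF _ countable_SIGMA[OF \<B>(1) \<B>(1)]]) auto
  have I: "\<exists>p\<in>I. \<phi> p x = 0 \<and> (\<forall>y\<in>topspace X - W. \<phi> p y = 1)" if W: "openin X W" "x \<in> W" for W x
  proof -
    obtain V where V: "V \<in> \<B>" "x \<in> V" "V \<subseteq> W" using \<B>(3) W by blast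
    have "closedin X (topspace X - V)" "x \<in> topspace X - (topspace X - V)"
      using \<B>(2)[OF V(1)] V(2) openin_subset by auto
    then obtain \<psi> where \<psi>: "continuous_map X euclideanreal \<psi>" "\<psi> x = 0" "\<psi> ` (topspace X - V) \<subseteq> {1}"
      using ty unfolding Tychonoff_space_def completely_regular_space_alt by blast
    have "openin X {y \<in> topspace X. \<psi> y \<in> {..<1/2}}"
      using \<psi>(1) by (rule openin_continuous_map_preimage) simp
    then obtain U where U: "U \<in> \<B>" "x \<in> U" "U \<subseteq> {y \<in> topspace X. \<psi> y \<in> {..<1/2}}"
      using \<B>(3)[of "{y \<in> topspace X. \<psi> y \<in> {..<1/2}}" x] \<psi>(2) W openin_subset by fastforce
    \<comment> \<open>Cutting \<open>\<psi>\<close> off makes it vanish on a whole member \<open>U\<close> of the base, so that the pair \<open>(U, V)\<close> determines what is required of it, whatever \<open>x\<close> is.\<close>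
    have "S (U, V) (\<lambda>y. max 0 (2 * \<psi> y - 1))"
      unfolding S_def using \<psi> U(3)
      by (auto intro!: continuous_map_real_max continuous_map_diff continuous_map_real_mult)
    then have "(U, V) \<in> I" using U(1) V(1) by (auto simp: I_def)
    then show ?thesis using \<phi>[of "(U, V)"] U(2) V(3) by (force simp: S_def)
  qed
  define e where "e = (\<lambda>x. \<lambda>p\<in>I. \<phi> p x)"
  define Z where "Z = subtopology (powertop_real I) (e ` topspace X)"
  have "continuous_map X (powertop_real I) e"
    unfolding continuous_map_componentwise e_def using \<phi> by (auto simp: S_def)
  then have ce: "continuous_map X Z e" and te: "e ` topspace X = topspace Z"
    unfolding Z_def by (auto simp: continuous_map_in_subtopology topspace_subtopology
        dest: continuous_map_image_subset_topspace)
  have loc: "\<exists>V. openin Z V \<and> e x \<in> V \<and> V \<subseteq> e ` W" if W: "openin X W" "x \<in> W" for W x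
  proof -
    have xX: "x \<in> topspace X" using W openin_subset by blast
    obtain p where p: "p \<in> I" "\<phi> p x = 0" "\<forall>y\<in>topspace X - W. \<phi> p y = 1" using I[OF W] by blast
    have "continuous_map Z euclideanreal (\<lambda>z. z p)"
      unfolding Z_def using p(1)
      by (intro continuous_map_from_subtopology continuous_map_product_projection)
    then have "openin Z {z \<in> topspace Z. z p \<in> {..<1}}"
      by (rule openin_continuous_map_preimage) simp
    moreover have "e x \<in> {z \<in> topspace Z. z p \<in> {..<1}}"
      using te xX p(1,2) by (auto simp: e_def)
    moreover have "{z \<in> topspace Z. z p \<in> {..<1}} \<subseteq> e ` W"
      using te p by (force simp: e_def)
    ultimately show ?thesis by blast
  qed
  have "open_map X Z e"
    unfolding open_map_def
  proof (intro allI impI)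
    fix W assume "openin X W"
    then show "openin Z (e ` W)" using loc by (subst openin_subopen) blast
  qed
  moreover have "inj_on e (topspace X)"
  proof (rule inj_onI, rule ccontr)
    fix x y assume xy: "x \<in> topspace X" "y \<in> topspace X" "e x = e y" "x \<noteq> y"
    have "openin X (topspace X - {y})"
      using ty xy(2) by (simp add: Tychonoff_space_def closedin_Hausdorff_singleton openin_diff)
    then obtain p where "p \<in> I" "\<phi> p x = 0" "\<phi> p y = 1" using I[of "topspace X - {y}" x] xy by auto
    then show False using fun_cong[OF xy(3), of p] by (simp add: e_def)
  qed
  ultimately have "homeomorphic_map X Z e"
    using ce te bijective_open_imp_homeomorphic_map by blast
  moreover have "metrizable_space Z"
    unfolding Z_def by (intro metrizable_space_subtopology)
      (auto simp: metrizable_space_product_topology metrizable_space_euclidean intro: countable_subset[OF _ \<open>countable I\<close>])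
  ultimately show ?thesis
    using homeomorphic_map_imp_homeomorphic_space homeomorphic_metrizable_space by blast
qed

section \<open>From a nonmetrizable factorizable space to a filter\<close>

text \<open>The filter is the trace, on a dense sequence \<open>d\<close>, of the neighbourhoods of a point \<open>a\<close> without
countable local base. If \<open>\<B>\<close> were a countable base of it, the interiors of the closures of the sets
\<open>d ` B\<close> would form a local base at \<open>a\<close>: by regularity they become small, and by density they are
neighbourhoods.\<close>

lemma nonmetrizable_factorizable_imp_A_filter:
  fixes X :: "'a topology"
  assumes ty: "Tychonoff_space X" and nm: "\<not> metrizable_space X" and fa: "R_omega1_factorizable X"
  shows "\<exists>F :: nat filter. A_filter F \<and> \<not> (\<exists>\<B>. countable \<B> \<and> filter_base F \<B>)"
proof -
  have "\<not> first_countable X"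
    using Tychonoff_second_countable_imp_metrizable[OF ty] nm
      R_omega1_factorizable_first_countable_imp_second_countable[OF ty fa] by blast
  then obtain a where a: "a \<in> topspace X" and nfc:
    "\<And>\<B>. countable \<B> \<Longrightarrow> (\<And>V. V \<in> \<B> \<Longrightarrow> openin X V) \<Longrightarrow>
        (\<And>U. openin X U \<Longrightarrow> a \<in> U \<Longrightarrow> \<exists>V\<in>\<B>. a \<in> V \<and> V \<subseteq> U) \<Longrightarrow> False"
    unfolding first_countable_def by metis
  obtain D where D: "countable D" "D \<subseteq> topspace X" "X closure_of D = topspace X"
    using R_omega1_factorizable_imp_separable_space[OF ty fa] unfolding separable_space_def by blast
  have "D \<noteq> {}" using D(3) a by auto
  define d where "d = from_nat_into D"
  have rd: "range d = D" unfolding d_def by (rule range_from_nat_into[OF \<open>D \<noteq> {}\<close> D(1)])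
  define F where "F = filtercomap d (nhdsin X a)"
  have F: "A \<in> filter_sets F \<longleftrightarrow> (\<exists>U. openin X U \<and> a \<in> U \<and> d -` U \<subseteq> A)" for A
  proof
    assume "A \<in> filter_sets F"
    then obtain Q U where "openin X U" "a \<in> U" "\<forall>x\<in>U. Q x" "\<forall>n. Q (d n) \<longrightarrow> n \<in> A"
      using a unfolding filter_sets_def F_def by (auto simp: eventually_filtercomap eventually_nhdsin)
    then show "\<exists>U. openin X U \<and> a \<in> U \<and> d -` U \<subseteq> A" by (intro exI[of _ U]) auto
  next
    assume "\<exists>U. openin X U \<and> a \<in> U \<and> d -` U \<subseteq> A"
    then obtain U where "openin X U" "a \<in> U" "d -` U \<subseteq> A" by (elim exE conjE)
    then show "A \<in> filter_sets F"
      unfolding filter_sets_def F_def mem_Collect_eq eventually_filtercomap eventually_nhdsin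
      by (intro exI[of _ "\<lambda>x. x \<in> U"]) auto
  qed
  have dense: "\<exists>n. d n \<in> U" if U: "openin X U" "a \<in> U" for U
  proof -
    have "a \<in> X closure_of D" using D(3) a by simp
    then obtain y where "y \<in> D" "y \<in> U" using U unfolding in_closure_of by blast
    then show ?thesis using rd by (metis rangeE)
  qed
  have "A_filter F"
    unfolding A_filter_def
  proof (intro conjI allI impI)
    have "{} \<notin> filter_sets F" using dense by (auto simp: F)
    then show "F \<noteq> bot" by (auto simp: filter_sets_def)
    fix \<Phi> :: "nat set \<Rightarrow> nat set" assume "\<forall>\<alpha>\<in>omega1. \<Phi> \<alpha> \<in> filter_sets F"
    then obtain U where U: "\<And>\<alpha>. \<alpha> \<in> omega1 \<Longrightarrow> openin X (U \<alpha>) \<and> a \<in> U \<alpha>"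
      "\<And>\<alpha>. \<alpha> \<in> omega1 \<Longrightarrow> d -` U \<alpha> \<subseteq> \<Phi> \<alpha>"
      unfolding F by metis
    obtain \<W> where \<W>: "countable \<W>" "\<forall>W\<in>\<W>. openin X W"
      "\<forall>\<alpha>\<in>omega1. \<exists>W\<in>\<W>. a \<in> W \<and> W \<subseteq> U \<alpha>"
      using R_omega1_factorizable_countable_refinement[OF ty fa, of U "\<lambda>_. a"] U(1) by blast
    define \<V> where "\<V> = {W \<in> insert (topspace X) \<W>. a \<in> W}"
    have \<V>: "countable \<V>" "\<V> \<noteq> {}" using \<W>(1) a
      by (auto simp: \<V>_def intro: countable_subset[OF _ countable_insert[OF \<W>(1)]])
    have r: "range (from_nat_into \<V>) = \<V>" by (rule range_from_nat_into[OF \<V>(2,1)])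
    show "\<exists>\<Gamma> :: nat \<Rightarrow> nat set. (\<forall>n. \<Gamma> n \<in> filter_sets F) \<and> (\<forall>\<alpha>\<in>omega1. \<exists>n. \<Gamma> n \<subseteq> \<Phi> \<alpha>)"
    proof (intro exI[of _ "\<lambda>n. d -` from_nat_into \<V> n"] conjI allI ballI)
      fix n
      have "from_nat_into \<V> n \<in> \<V>" using \<V>(2) by (rule from_nat_into)
      then show "d -` from_nat_into \<V> n \<in> filter_sets F"
        unfolding F \<V>_def using \<W>(2) by auto
    next
      fix \<alpha> assume \<alpha>: "\<alpha> \<in> omega1"
      then obtain W where W: "W \<in> \<W>" "a \<in> W" "W \<subseteq> U \<alpha>" using \<W>(3) by blast
      then have "W \<in> range (from_nat_into \<V>)" unfolding r by (auto simp: \<V>_def)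
      then obtain n where "from_nat_into \<V> n = W" by blast
      then show "\<exists>n. d -` from_nat_into \<V> n \<subseteq> \<Phi> \<alpha>" using W(3) U(2)[OF \<alpha>] by blast
    qed
  qed
  moreover have "\<not> (\<exists>\<B>. countable \<B> \<and> filter_base F \<B>)"
  proof
    assume "\<exists>\<B>. countable \<B> \<and> filter_base F \<B>"
    then obtain \<B> where "countable \<B>" "filter_base F \<B>" by (elim exE conjE)
    then have \<B>: "countable \<B>" "\<B> \<subseteq> filter_sets F" "\<forall>A\<in>filter_sets F. \<exists>B\<in>\<B>. B \<subseteq> A"
      unfolding filter_base_def by simp_all
    define i where "i = (\<lambda>B. X interior_of (X closure_of (d ` B)))"
    show False
    proof (rule nfc[of "i ` \<B>"])
      show "countable (i ` \<B>)" using \<B>(1) by simp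
      show "openin X V" if "V \<in> i ` \<B>" for V using that by (auto simp: i_def)
      fix U assume U: "openin X U" "a \<in> U"
      have "neighbourhood_base_of (closedin X) X"
        using ty completely_regular_imp_regular_space neighbourhood_base_of_closedin
        unfolding Tychonoff_space_def by blast
      then obtain V C where VC: "openin X V" "closedin X C" "a \<in> V" "V \<subseteq> C" "C \<subseteq> U"
        unfolding neighbourhood_base_of using U by metis
      have "d -` V \<in> filter_sets F" unfolding F using VC by blast
      then obtain B where B: "B \<in> \<B>" "B \<subseteq> d -` V" using \<B>(3) by blast
      obtain W where W: "openin X W" "a \<in> W" "d -` W \<subseteq> B" using \<B>(2) B(1) F by blast
      have "W = W \<inter> X closure_of D" using W(1) D(3) openin_subset by blast
      also have "\<dots> \<subseteq> X closure_of (W \<inter> D)"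
        using openin_Int_closure_of_subset[OF W(1)] by blast
      also have "\<dots> \<subseteq> X closure_of (d ` B)"
        using W(3) rd by (intro closure_of_mono) blast
      finally have "W \<subseteq> i B" unfolding i_def using W(1) by (simp add: interior_of_maximal)
      moreover have "i B \<subseteq> U"
      proof -
        have "X closure_of (d ` B) \<subseteq> C" using B(2) VC(2,4) by (intro closure_of_minimal) auto
        then show ?thesis unfolding i_def using VC(5) by (meson interior_of_subset order_trans)
      qed
      ultimately show "\<exists>V\<in>i ` \<B>. a \<in> V \<and> V \<subseteq> U" using B(1) W(2) by blast
    qed
  qed
  ultimately show ?thesis by blast
qed

section \<open>Topologies given by set-valued ultrametrics\<close>

text \<open>A distance with values in sets, where union and inclusion play the roles of maximum and order; the
members of \<open>\<A>\<close> are the admissible radii. For the Boolean group of finite sets the distance is the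
symmetric difference and the cells around the neutral element are subgroups. Leaving \<open>\<A>\<close> arbitrary
allows passing from a filter to a countable subfamily while keeping the distance.\<close>

locale set_valued_ultrametric =
  fixes C :: "'a set" and \<delta> :: "'a \<Rightarrow> 'a \<Rightarrow> 'i set" and \<A> :: "'i set set"
  assumes refl: "\<delta> x x = {}"
    and sym: "\<delta> x y = \<delta> y x"
    and triangle: "\<delta> x z \<subseteq> \<delta> x y \<union> \<delta> y z"
    and nonempty: "\<A> \<noteq> {}"
    and directed: "A \<in> \<A> \<Longrightarrow> B \<in> \<A> \<Longrightarrow> \<exists>D\<in>\<A>. D \<subseteq> A \<inter> B"
    and separating: "x \<in> C \<Longrightarrow> y \<in> C \<Longrightarrow> x \<noteq> y \<Longrightarrow> \<exists>A\<in>\<A>. \<not> \<delta> x y \<subseteq> A"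
begin

definition cell :: "'a \<Rightarrow> 'i set \<Rightarrow> 'a set" where
  "cell x A = {y \<in> C. \<delta> x y \<subseteq> A}"

definition cell_topology :: "'a topology" where
  "cell_topology = topology (\<lambda>U. U \<subseteq> C \<and> (\<forall>x\<in>U. \<exists>A\<in>\<A>. cell x A \<subseteq> U))"

lemma cell_mono: "A \<subseteq> B \<Longrightarrow> cell x A \<subseteq> cell x B"
  by (auto simp: cell_def)

lemma centre_in_cell: "x \<in> C \<Longrightarrow> x \<in> cell x A"
  by (simp add: cell_def refl)

lemma cell_subset_cell:
  assumes "y \<in> cell x A"
  shows "cell y A \<subseteq> cell x A"
  using assms triangle[of x _ y] unfolding cell_def by blast

lemma openin_cell_topology:
  "openin cell_topology U \<longleftrightarrow> U \<subseteq> C \<and> (\<forall>x\<in>U. \<exists>A\<in>\<A>. cell x A \<subseteq> U)"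
proof -
  have "istopology (\<lambda>U. U \<subseteq> C \<and> (\<forall>x\<in>U. \<exists>A\<in>\<A>. cell x A \<subseteq> U))"
    unfolding istopology_def
  proof (intro conjI allI impI ballI)
    fix S T x
    assume S: "S \<subseteq> C \<and> (\<forall>x\<in>S. \<exists>A\<in>\<A>. cell x A \<subseteq> S)"
      and T: "T \<subseteq> C \<and> (\<forall>x\<in>T. \<exists>A\<in>\<A>. cell x A \<subseteq> T)"
    show "S \<inter> T \<subseteq> C" using S by blast
    assume x: "x \<in> S \<inter> T"
    then obtain A B where AB: "A \<in> \<A>" "cell x A \<subseteq> S" "B \<in> \<A>" "cell x B \<subseteq> T"
      using S T by blast
    obtain D where "D \<in> \<A>" "D \<subseteq> A \<inter> B" using directed[OF AB(1,3)] by blast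
    then show "\<exists>A\<in>\<A>. cell x A \<subseteq> S \<inter> T"
      using AB cell_mono[of D A x] cell_mono[of D B x] by blast
  next
    fix \<K> assume "\<forall>K\<in>\<K>. K \<subseteq> C \<and> (\<forall>x\<in>K. \<exists>A\<in>\<A>. cell x A \<subseteq> K)"
    then show "\<Union>\<K> \<subseteq> C" and "\<And>x. x \<in> \<Union>\<K> \<Longrightarrow> \<exists>A\<in>\<A>. cell x A \<subseteq> \<Union>\<K>"
      by (blast, meson Union_iff Union_upper order_trans)
  qed
  then show ?thesis by (simp add: cell_topology_def topology_inverse')
qed

lemma topspace_cell_topology: "topspace cell_topology = C"
proof (rule subset_antisym)
  show "topspace cell_topology \<subseteq> C"
    using openin_topspace[of cell_topology] unfolding openin_cell_topology by blast
  have "openin cell_topology C"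
    unfolding openin_cell_topology using nonempty by (auto simp: cell_def)
  then show "C \<subseteq> topspace cell_topology" by (rule openin_subset)
qed

lemma openin_cell: "A \<in> \<A> \<Longrightarrow> openin cell_topology (cell x A)"
  unfolding openin_cell_topology using cell_subset_cell by (metis (no_types, lifting) cell_def mem_Collect_eq subsetI)

lemma closedin_cell:
  assumes "A \<in> \<A>"
  shows "closedin cell_topology (cell x A)"
proof -
  have "cell y A \<subseteq> C - cell x A" if "y \<in> C - cell x A" for y
    using that triangle[of x y] sym unfolding cell_def by blast
  then have "openin cell_topology (C - cell x A)"
    unfolding openin_cell_topology using assms by blast
  then show ?thesis by (simp add: closedin_def topspace_cell_topology cell_def)
qed

text \<open>As in every ultrametric space, cells are both open and closed.\<close>

lemma Tychonoff_cell_topology: "Tychonoff_space cell_topology"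
  unfolding Tychonoff_space_def
proof
  have "\<exists>V. closedin cell_topology V \<and> openin cell_topology V \<and> x \<in> V \<and> V \<subseteq> U"
    if U: "openin cell_topology U" "x \<in> U" for U x
  proof -
    obtain A where "A \<in> \<A>" "cell x A \<subseteq> U" "x \<in> C"
      using U unfolding openin_cell_topology by blast
    then show ?thesis using openin_cell closedin_cell centre_in_cell by (intro exI[of _ "cell x A"]) simp
  qed
  then have "cell_topology dim_le 0"
    unfolding dimension_le_0_neighbourhood_base_of_clopen
    by (subst open_neighbourhood_base_of) blast+
  then show "completely_regular_space cell_topology"
    by (rule zero_dimensional_imp_completely_regular_space)
  show "Hausdorff_space cell_topology"
    unfolding Hausdorff_space_def topspace_cell_topology
  proof (intro allI impI)
    fix x y assume xy: "x \<in> C \<and> y \<in> C \<and> x \<noteq> y"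
    then obtain A where A: "A \<in> \<A>" "\<not> \<delta> x y \<subseteq> A" using separating by blast
    have "disjnt (cell x A) (cell y A)"
      using A(2) triangle[of x y] sym unfolding disjnt_iff cell_def by blast
    then show "\<exists>U V. openin cell_topology U \<and> openin cell_topology V \<and> x \<in> U \<and> y \<in> V \<and> disjnt U V"
      using openin_cell[OF A(1)] centre_in_cell xy by blast
  qed
qed

lemma second_countable_cell_topology:
  assumes "countable C" "countable \<A>"
  shows "second_countable cell_topology"
  unfolding second_countable_def
proof (intro exI[of _ "(\<lambda>(x, A). cell x A) ` (C \<times> \<A>)"] conjI ballI allI impI)
  show "countable ((\<lambda>(x, A). cell x A) ` (C \<times> \<A>))" using assms by simp
  show "openin cell_topology V" if "V \<in> (\<lambda>(x, A). cell x A) ` (C \<times> \<A>)" for V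
    using that openin_cell by auto
  fix U x assume U: "openin cell_topology U \<and> x \<in> U"
  then obtain A where A: "A \<in> \<A>" "cell x A \<subseteq> U" "x \<in> C"
    unfolding openin_cell_topology by blast
  then show "\<exists>V\<in>(\<lambda>(x, A). cell x A) ` (C \<times> \<A>). x \<in> V \<and> V \<subseteq> U"
    using centre_in_cell by (intro bexI[of _ "cell x A"]) auto
qed

lemma continuous_map_cell_topology_real:
  "continuous_map cell_topology euclideanreal f \<longleftrightarrow>
    (\<forall>x\<in>C. \<forall>k::nat. \<exists>A\<in>\<A>. \<forall>y\<in>cell x A. \<bar>f y - f x\<bar> < 1 / Suc k)"
proof
  assume f: "continuous_map cell_topology euclideanreal f"
  show "\<forall>x\<in>C. \<forall>k::nat. \<exists>A\<in>\<A>. \<forall>y\<in>cell x A. \<bar>f y - f x\<bar> < 1 / Suc k"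
  proof (intro ballI allI)
    fix x k assume x: "x \<in> C"
    let ?U = "{y \<in> topspace cell_topology. f y \<in> {f x - 1 / Suc k <..< f x + 1 / Suc k}}"
    have "openin cell_topology ?U" by (rule openin_continuous_map_preimage[OF f]) simp
    moreover have "x \<in> ?U" using x by (simp add: topspace_cell_topology)
    ultimately obtain A where A: "A \<in> \<A>" "cell x A \<subseteq> ?U" unfolding openin_cell_topology by blast
    have "\<bar>f y - f x\<bar> < 1 / Suc k" if "y \<in> cell x A" for y
      using subsetD[OF A(2) that] by auto
    then show "\<exists>A\<in>\<A>. \<forall>y\<in>cell x A. \<bar>f y - f x\<bar> < 1 / Suc k" using A(1) by blast
  qed
next
  assume R: "\<forall>x\<in>C. \<forall>k::nat. \<exists>A\<in>\<A>. \<forall>y\<in>cell x A. \<bar>f y - f x\<bar> < 1 / Suc k"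
  have "openin cell_topology {x \<in> C. f x \<in> U}" if U: "open U" for U
    unfolding openin_cell_topology
  proof (intro conjI ballI)
    fix x assume x: "x \<in> {x \<in> C. f x \<in> U}"
    then obtain \<epsilon> where \<epsilon>: "\<epsilon> > 0" "\<And>r. \<bar>r - f x\<bar> < \<epsilon> \<Longrightarrow> r \<in> U"
      using U unfolding open_dist dist_real_def by blast
    obtain k :: nat where k: "1 / Suc k < \<epsilon>" using nat_approx_posE[OF \<epsilon>(1)] by blast
    obtain A where A: "A \<in> \<A>" "\<forall>y\<in>cell x A. \<bar>f y - f x\<bar> < 1 / Suc k" using R x by blast
    have "f y \<in> U" if "y \<in> cell x A" for y
      using A(2)[rule_format, OF that] k \<epsilon>(2) by (meson order_less_trans)
    then have "cell x A \<subseteq> {x \<in> C. f x \<in> U}" by (auto simp: cell_def)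
    then show "\<exists>A\<in>\<A>. cell x A \<subseteq> {x \<in> C. f x \<in> U}" using A(1) by blast
  qed auto
  then show "continuous_map cell_topology euclideanreal f"
    by (simp add: continuous_map_def topspace_cell_topology)
qed

text \<open>Adding to \<open>\<G>\<close> one separating radius for each pair of distinct points, and closing under finite
intersections, preserves countability and restores the separation and directedness conditions.\<close>

lemma countable_subfamily:
  assumes C: "countable C" and \<G>: "countable \<G>" "\<G> \<subseteq> \<A>"
    and inter: "\<And>\<E>. finite \<E> \<Longrightarrow> \<E> \<subseteq> \<A> \<Longrightarrow> \<Inter>\<E> \<in> \<A>"
  obtains \<S> where "countable \<S>" "\<G> \<subseteq> \<S>" "\<S> \<subseteq> \<A>" "set_valued_ultrametric C \<delta> \<S>"
proof -
  define s where "s = (\<lambda>(x, y). SOME A. A \<in> \<A> \<and> \<not> \<delta> x y \<subseteq> A)"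
  have s: "s (x, y) \<in> \<A> \<and> \<not> \<delta> x y \<subseteq> s (x, y)" if "x \<in> C" "y \<in> C" "x \<noteq> y" for x y
    unfolding s_def prod.case by (rule someI_ex) (use separating[OF that] in blast)
  define \<H> where "\<H> = \<G> \<union> s ` {(x, y) \<in> C \<times> C. x \<noteq> y}"
  define \<S> where "\<S> = Inter ` {\<E>. finite \<E> \<and> \<E> \<subseteq> \<H>}"
  have "countable {(x, y) \<in> C \<times> C. x \<noteq> y}"
    by (rule countable_subset[OF _ countable_SIGMA[OF C C]]) auto
  then have "countable \<H>" unfolding \<H>_def using \<G>(1) by blast
  then have c\<S>: "countable \<S>" unfolding \<S>_def by (intro countable_image countable_Collect_finite_subset)
  have "\<H> \<subseteq> \<A>" unfolding \<H>_def using \<G>(2) s by auto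
  then have "\<S> \<subseteq> \<A>" unfolding \<S>_def using inter by blast
  have "A \<in> \<S>" if "A \<in> \<H>" for A
    unfolding \<S>_def by (rule image_eqI[of _ _ "{A}"]) (use that in auto)
  then have "\<H> \<subseteq> \<S>" by blast
  then have "\<G> \<subseteq> \<S>" unfolding \<H>_def by blast
  have "set_valued_ultrametric C \<delta> \<S>"
  proof
    show "\<S> \<noteq> {}" unfolding \<S>_def by blast
    fix A B assume "A \<in> \<S>" "B \<in> \<S>"
    then obtain \<D> \<E> where "finite \<D>" "\<D> \<subseteq> \<H>" "A = \<Inter>\<D>" "finite \<E>" "\<E> \<subseteq> \<H>" "B = \<Inter>\<E>"
      unfolding \<S>_def by blast
    then have "A \<inter> B = \<Inter>(\<D> \<union> \<E>)" "finite (\<D> \<union> \<E>)" "\<D> \<union> \<E> \<subseteq> \<H>" by auto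
    then have "A \<inter> B \<in> \<S>" unfolding \<S>_def by blast
    then show "\<exists>D\<in>\<S>. D \<subseteq> A \<inter> B" by blast
  next
    fix x y assume "x \<in> C" "y \<in> C" "x \<noteq> y"
    then have "s (x, y) \<in> \<H>" "\<not> \<delta> x y \<subseteq> s (x, y)" using s unfolding \<H>_def by auto
    then show "\<exists>A\<in>\<S>. \<not> \<delta> x y \<subseteq> A" using \<open>\<H> \<subseteq> \<S>\<close> by blast
  qed (use refl sym triangle in auto)
  with c\<S> \<open>\<G> \<subseteq> \<S>\<close> \<open>\<S> \<subseteq> \<A>\<close> show thesis by (rule that)
qed

text \<open>By the \<open>A\<close>-property, for each point \<open>x\<close> and each precision \<open>1 / Suc k\<close> countably many radii suffice for
the continuity estimates of all \<open>\<omega>\<^sub>1\<close> coordinates of \<open>f\<close> at \<open>x\<close>. The topology from a countable family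
containing all these radii is, up to a homeomorphism, the intermediate space, and the identity is the first factor.\<close>

lemma R_omega1_factorizable_cell_topology:
  assumes C: "countable C" and F: "A_filter F" "\<A> = filter_sets F"
  shows "R_omega1_factorizable cell_topology"
  unfolding R_omega1_factorizable_def
proof (intro allI impI)
  fix f assume f: "continuous_map cell_topology (powertop_real omega1) f"
  have "\<exists>\<Gamma> :: nat \<Rightarrow> 'i set. (\<forall>n. \<Gamma> n \<in> \<A>) \<and>
      (\<forall>\<alpha>\<in>omega1. \<exists>n. \<forall>y\<in>cell x (\<Gamma> n). \<bar>f y \<alpha> - f x \<alpha>\<bar> < 1 / Suc k)"
    if x: "x \<in> C" for x and k :: nat
  proof -
    have "\<forall>\<alpha>\<in>omega1. \<exists>A. A \<in> \<A> \<and> (\<forall>y\<in>cell x A. \<bar>f y \<alpha> - f x \<alpha>\<bar> < 1 / Suc k)"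
    proof
      fix \<alpha> assume "\<alpha> \<in> omega1"
      then have "continuous_map cell_topology euclideanreal (\<lambda>x. f x \<alpha>)"
        using f unfolding continuous_map_componentwise by blast
      then show "\<exists>A. A \<in> \<A> \<and> (\<forall>y\<in>cell x A. \<bar>f y \<alpha> - f x \<alpha>\<bar> < 1 / Suc k)"
        unfolding continuous_map_cell_topology_real using x by blast
    qed
    from bchoice[OF this] obtain \<Phi> where \<Phi>: "\<forall>\<alpha>\<in>omega1. \<Phi> \<alpha> \<in> \<A> \<and>
        (\<forall>y\<in>cell x (\<Phi> \<alpha>). \<bar>f y \<alpha> - f x \<alpha>\<bar> < 1 / Suc k)" by (elim exE)
    then have "\<forall>\<alpha>\<in>omega1. \<Phi> \<alpha> \<in> filter_sets F" by (simp add: F(2))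
    from F(1)[unfolded A_filter_def, THEN conjunct2, THEN spec, THEN mp, OF this]
    obtain \<Gamma> :: "nat \<Rightarrow> 'i set" where \<Gamma>: "\<forall>n. \<Gamma> n \<in> \<A>" "\<forall>\<alpha>\<in>omega1. \<exists>n. \<Gamma> n \<subseteq> \<Phi> \<alpha>"
      unfolding F(2) by (elim exE conjE)
    have "\<exists>n. \<forall>y\<in>cell x (\<Gamma> n). \<bar>f y \<alpha> - f x \<alpha>\<bar> < 1 / Suc k" if \<alpha>: "\<alpha> \<in> omega1" for \<alpha>
    proof -
      obtain n where "\<Gamma> n \<subseteq> \<Phi> \<alpha>" using \<Gamma>(2) \<alpha> by blast
      then show ?thesis using \<Phi> \<alpha> cell_mono[of "\<Gamma> n" "\<Phi> \<alpha>" x] by blast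
    qed
    then show ?thesis using \<Gamma>(1) by blast
  qed
  then have "\<forall>p\<in>C \<times> (UNIV :: nat set). \<exists>\<Gamma> :: nat \<Rightarrow> 'i set. (\<forall>n. \<Gamma> n \<in> \<A>) \<and>
      (\<forall>\<alpha>\<in>omega1. \<exists>n. \<forall>y\<in>cell (fst p) (\<Gamma> n). \<bar>f y \<alpha> - f (fst p) \<alpha>\<bar> < 1 / Suc (snd p))"
    by simp
  from bchoice[OF this] obtain \<Gamma> where \<Gamma>: "\<forall>p\<in>C \<times> (UNIV :: nat set). (\<forall>n :: nat. \<Gamma> p n \<in> \<A>) \<and>
      (\<forall>\<alpha>\<in>omega1. \<exists>n. \<forall>y\<in>cell (fst p) (\<Gamma> p n). \<bar>f y \<alpha> - f (fst p) \<alpha>\<bar> < 1 / Suc (snd p))"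
    by (elim exE)
  define \<G> where "\<G> = (\<Union>p\<in>C \<times> UNIV. range (\<Gamma> p))"
  have "countable \<G>" unfolding \<G>_def using C by simp
  moreover have "\<G> \<subseteq> \<A>" unfolding \<G>_def using \<Gamma> by blast
  moreover have "\<Inter>\<E> \<in> \<A>" if "finite \<E>" "\<E> \<subseteq> \<A>" for \<E>
    using that unfolding F(2) filter_sets_def
    by (induction \<E>) (auto simp: eventually_conj_iff)
  ultimately obtain \<S> where \<S>: "countable \<S>" "\<G> \<subseteq> \<S>" "\<S> \<subseteq> \<A>" "set_valued_ultrametric C \<delta> \<S>"
    using countable_subfamily[OF C] by metis
  interpret S: set_valued_ultrametric C \<delta> \<S> by (rule \<S>(4))
  have "openin S.cell_topology U \<Longrightarrow> openin cell_topology U" for U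
    unfolding openin_cell_topology S.openin_cell_topology using \<S>(3) by blast
  moreover have "{x \<in> C. id x \<in> U} = U" if "openin S.cell_topology U" for U
    using that unfolding S.openin_cell_topology by auto
  ultimately have id: "continuous_map cell_topology S.cell_topology id"
    by (simp add: continuous_map_def topspace_cell_topology S.topspace_cell_topology)
  have fS: "continuous_map S.cell_topology (powertop_real omega1) f"
    unfolding continuous_map_componentwise
  proof (intro conjI ballI)
    show "f ` topspace S.cell_topology \<subseteq> extensional omega1"
      using f unfolding continuous_map_componentwise topspace_cell_topology S.topspace_cell_topology
      by blast
    fix \<alpha> assume \<alpha>: "\<alpha> \<in> omega1"
    show "continuous_map S.cell_topology euclideanreal (\<lambda>x. f x \<alpha>)"
      unfolding S.continuous_map_cell_topology_real
    proof (intro ballI allI)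
      fix x and k :: nat assume "x \<in> C"
      then have xk: "(x, k) \<in> C \<times> UNIV" by simp
      then obtain n where "\<forall>y\<in>cell x (\<Gamma> (x, k) n). \<bar>f y \<alpha> - f x \<alpha>\<bar> < 1 / Suc k"
        using bspec[OF \<Gamma> xk] \<alpha> unfolding fst_conv snd_conv by blast
      moreover have "\<Gamma> (x, k) n \<in> \<S>" using xk \<S>(2) unfolding \<G>_def by blast
      ultimately show "\<exists>A\<in>\<S>. \<forall>y\<in>cell x A. \<bar>f y \<alpha> - f x \<alpha>\<bar> < 1 / Suc k" by blast
    qed
  qed
  have sc: "second_countable S.cell_topology"
    using C \<S>(1) by (rule S.second_countable_cell_topology)
  obtain Z :: "nat set topology" where Z: "S.cell_topology homeomorphic_space Z"
    using second_countable_homeomorphic_nat_set[OF sc] S.Tychonoff_cell_topology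
    unfolding Tychonoff_space_def by metis
  then obtain h h' where h: "homeomorphic_maps S.cell_topology Z h h'"
    unfolding homeomorphic_space_def by blast
  show "\<exists>(Y :: nat set topology) h g. Tychonoff_space Y \<and> second_countable Y \<and>
      continuous_map cell_topology Y h \<and> continuous_map Y (powertop_real omega1) g \<and>
      (\<forall>x\<in>topspace cell_topology. f x = g (h x))"
  proof (intro exI[of _ Z] exI[of _ "h \<circ> id"] exI[of _ "f \<circ> h'"] conjI)
    show "Tychonoff_space Z"
      using S.Tychonoff_cell_topology homeomorphic_completely_regular_space[OF Z]
        homeomorphic_Hausdorff_space[OF Z] by (simp add: Tychonoff_space_def)
    show "second_countable Z" using sc homeomorphic_space_second_countability[OF Z] by simp
    show "continuous_map cell_topology Z (h \<circ> id)"
      using id h unfolding homeomorphic_maps_def by (intro continuous_map_compose) auto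
    show "continuous_map Z (powertop_real omega1) (f \<circ> h')"
      using fS h unfolding homeomorphic_maps_def by (intro continuous_map_compose) auto
    show "\<forall>x\<in>topspace cell_topology. f x = (f \<circ> h') ((h \<circ> id) x)"
      using h unfolding homeomorphic_maps_def topspace_cell_topology S.topspace_cell_topology by simp
  qed
qed

end

section \<open>From a filter to a nonmetrizable factorizable group\<close>

text \<open>Removing \<open>K = \<Inter>F\<close> from the underlying set makes the group topology Hausdorff, and it loses no
information about \<open>F\<close>, since every element of \<open>F\<close> contains \<open>K\<close>. The group lives on an arbitrary
infinite type through an injection \<open>e\<close> of the countable set of finite subsets of \<open>- K\<close>, with inverse
\<open>d\<close>.\<close>

lemma A_filter_imp_nonmetrizable_factorizable_group:
  fixes F :: "nat filter"
  assumes inf: "infinite (UNIV :: 'b set)"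
    and F: "A_filter F" and nb: "\<not> (\<exists>\<B>. countable \<B> \<and> filter_base F \<B>)"
  shows "\<exists>(G :: 'b monoid) T. topological_group G T \<and>
    Tychonoff_space T \<and> \<not> metrizable_space T \<and> R_omega1_factorizable T"
proof -
  define K where "K = \<Inter>(filter_sets F)"
  define E where "E = {s :: nat set. finite s \<and> s \<subseteq> - K}"
  have "countable E" unfolding E_def
    by (rule countable_subset[OF _ countable_Collect_finite]) auto
  obtain j :: "nat \<Rightarrow> 'b" where j: "inj j"
    using infinite_countable_subset[OF inf] by blast
  define e where "e = j \<circ> to_nat_on E"
  have inje: "inj_on e E"
    unfolding e_def using \<open>countable E\<close> j by (intro comp_inj_on) (auto intro: inj_on_subset)
  define C where "C = e ` E"
  define d where "d = inv_into E e"
  have de: "d (e s) = s" if "s \<in> E" for s unfolding d_def using inje that by (rule inv_into_f_f)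
  have dE: "d x \<in> E" and ed: "e (d x) = x" if "x \<in> C" for x
    using that de unfolding C_def by auto
  have cC: "countable C" unfolding C_def using \<open>countable E\<close> by simp
  have eC: "e s \<in> C" if "s \<in> E" for s using that by (simp add: C_def)
  have sdE: "sym_diff s t \<in> E" if "s \<in> E" "t \<in> E" for s t using that unfolding E_def by auto
  define \<delta> where "\<delta> = (\<lambda>x y. sym_diff (d x) (d y))"
  have "set_valued_ultrametric C \<delta> (filter_sets F)"
  proof
    have "UNIV \<in> filter_sets F" by (simp add: filter_sets_def)
    then show "filter_sets F \<noteq> {}" by blast
    fix A B assume "A \<in> filter_sets F" "B \<in> filter_sets F"
    then have "A \<inter> B \<in> filter_sets F" by (simp add: filter_sets_def eventually_conj)
    then show "\<exists>D\<in>filter_sets F. D \<subseteq> A \<inter> B" by blast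
  next
    fix x y assume xy: "x \<in> C" "y \<in> C" "x \<noteq> y"
    then have "d x \<noteq> d y" using ed by metis
    then obtain m where m: "m \<in> \<delta> x y" unfolding \<delta>_def by blast
    then have "m \<notin> K" using dE[OF xy(1)] dE[OF xy(2)] unfolding \<delta>_def E_def by auto
    then show "\<exists>A\<in>filter_sets F. \<not> \<delta> x y \<subseteq> A" using m unfolding K_def by blast
  qed (auto simp: \<delta>_def)
  then interpret set_valued_ultrametric C \<delta> "filter_sets F" .
  define G :: "'b monoid" where
    "G = \<lparr>carrier = C, mult = (\<lambda>x y. e (sym_diff (d x) (d y))), one = e {}\<rparr>"
  have G: "carrier G = C" "\<one>\<^bsub>G\<^esub> = e {}" "\<And>x y. x \<otimes>\<^bsub>G\<^esub> y = e (sym_diff (d x) (d y))"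
    by (simp_all add: G_def)
  have "{} \<in> E" by (simp add: E_def)
  have dm: "d (x \<otimes>\<^bsub>G\<^esub> y) = sym_diff (d x) (d y)" if "x \<in> C" "y \<in> C" for x y
    unfolding G(3) using that dE sdE de by simp
  have mC: "x \<otimes>\<^bsub>G\<^esub> y \<in> C" if "x \<in> C" "y \<in> C" for x y
    unfolding G(3) using that dE sdE eC by simp
  have dinj: "x = y" if "x \<in> C" "y \<in> C" "d x = d y" for x y
    using that ed by metis
  have xx: "x \<otimes>\<^bsub>G\<^esub> x = \<one>\<^bsub>G\<^esub>" for x by (simp add: G)
  have "group G"
  proof (rule groupI)
    show "x \<otimes>\<^bsub>G\<^esub> y \<in> carrier G" if "x \<in> carrier G" "y \<in> carrier G" for x y
      using that mC by (simp add: G(1))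
    show "\<one>\<^bsub>G\<^esub> \<in> carrier G" using \<open>{} \<in> E\<close> eC by (simp add: G(1,2))
    show "x \<otimes>\<^bsub>G\<^esub> y \<otimes>\<^bsub>G\<^esub> z = x \<otimes>\<^bsub>G\<^esub> (y \<otimes>\<^bsub>G\<^esub> z)"
      if "x \<in> carrier G" "y \<in> carrier G" "z \<in> carrier G" for x y z
    proof (rule dinj)
      show "d (x \<otimes>\<^bsub>G\<^esub> y \<otimes>\<^bsub>G\<^esub> z) = d (x \<otimes>\<^bsub>G\<^esub> (y \<otimes>\<^bsub>G\<^esub> z))"
        using that mC unfolding G(1) by (simp add: dm) blast
    qed (use that mC in \<open>simp_all add: G(1)\<close>)
    show "\<one>\<^bsub>G\<^esub> \<otimes>\<^bsub>G\<^esub> x = x" if "x \<in> carrier G" for x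
      using that ed de[OF \<open>{} \<in> E\<close>] by (simp add: G)
    show "\<exists>y\<in>carrier G. y \<otimes>\<^bsub>G\<^esub> x = \<one>\<^bsub>G\<^esub>" if "x \<in> carrier G" for x
      using that xx by blast
  qed
  then interpret G: group G .
  have inv: "inv\<^bsub>G\<^esub> x = x" if "x \<in> C" for x
    using that xx by (intro G.inv_equality) (simp_all add: G(1))
  have "topological_group G cell_topology"
    unfolding topological_group_def
  proof (intro conjI)
    show "continuous_map (prod_topology cell_topology cell_topology) cell_topology (\<lambda>(x, y). x \<otimes>\<^bsub>G\<^esub> y)"
      unfolding continuous_map_def
    proof (intro conjI allI impI)
      show "(\<lambda>(x, y). x \<otimes>\<^bsub>G\<^esub> y) \<in> topspace (prod_topology cell_topology cell_topology) \<rightarrow> topspace cell_topology"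
        using mC by (auto simp: topspace_cell_topology)
      fix U assume U: "openin cell_topology U"
      show "openin (prod_topology cell_topology cell_topology)
          {p \<in> topspace (prod_topology cell_topology cell_topology). (\<lambda>(x, y). x \<otimes>\<^bsub>G\<^esub> y) p \<in> U}"
        unfolding openin_prod_topology_alt
      proof (intro allI impI)
        fix x y assume "(x, y) \<in> {p \<in> topspace (prod_topology cell_topology cell_topology). (\<lambda>(x, y). x \<otimes>\<^bsub>G\<^esub> y) p \<in> U}"
        then have xy: "x \<in> C" "y \<in> C" "x \<otimes>\<^bsub>G\<^esub> y \<in> U" by (auto simp: topspace_cell_topology)
        then obtain A where A: "A \<in> filter_sets F" "cell (x \<otimes>\<^bsub>G\<^esub> y) A \<subseteq> U"
          using U unfolding openin_cell_topology by blast
        have "x' \<otimes>\<^bsub>G\<^esub> y' \<in> U" if "x' \<in> cell x A" "y' \<in> cell y A" for x' y'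
        proof -
          have C': "x' \<in> C" "y' \<in> C" using that by (auto simp: cell_def)
          have "\<delta> (x \<otimes>\<^bsub>G\<^esub> y) (x' \<otimes>\<^bsub>G\<^esub> y') \<subseteq> \<delta> x x' \<union> \<delta> y y'"
            unfolding \<delta>_def dm[OF xy(1,2)] dm[OF C'] by blast
          then have "x' \<otimes>\<^bsub>G\<^esub> y' \<in> cell (x \<otimes>\<^bsub>G\<^esub> y) A"
            using that mC[OF C'] by (auto simp: cell_def)
          then show ?thesis using A(2) by blast
        qed
        then show "\<exists>V W. openin cell_topology V \<and> openin cell_topology W \<and> x \<in> V \<and> y \<in> W \<and>
            V \<times> W \<subseteq> {p \<in> topspace (prod_topology cell_topology cell_topology). (\<lambda>(x, y). x \<otimes>\<^bsub>G\<^esub> y) p \<in> U}"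
          using openin_cell[OF A(1)] centre_in_cell xy(1,2)
          by (intro exI[of _ "cell x A"] exI[of _ "cell y A"]) (auto simp: topspace_cell_topology cell_def)
      qed
    qed
    show "continuous_map cell_topology cell_topology (\<lambda>x. inv\<^bsub>G\<^esub> x)"
      by (rule continuous_map_eq[OF continuous_map_id]) (simp add: topspace_cell_topology inv)
  qed (simp_all add: \<open>group G\<close> topspace_cell_topology G(1))
  moreover have "\<not> metrizable_space cell_topology"
  proof
    assume "metrizable_space cell_topology"
    then have "first_countable cell_topology" by (rule metrizable_imp_first_countable)
    moreover have e0: "e {} \<in> C" using \<open>{} \<in> E\<close> by (rule eC)
    ultimately obtain \<V> where \<V>: "countable \<V>" "\<forall>V\<in>\<V>. openin cell_topology V"
      "\<forall>U. openin cell_topology U \<and> e {} \<in> U \<longrightarrow> (\<exists>V\<in>\<V>. e {} \<in> V \<and> V \<subseteq> U)"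
      unfolding first_countable_def topspace_cell_topology by (meson)
    have "\<forall>V\<in>{V\<in>\<V>. e {} \<in> V}. \<exists>A. A \<in> filter_sets F \<and> cell (e {}) A \<subseteq> V"
      using \<V>(2) unfolding openin_cell_topology by blast
    from bchoice[OF this] obtain a where a: "\<forall>V\<in>{V\<in>\<V>. e {} \<in> V}. a V \<in> filter_sets F \<and> cell (e {}) (a V) \<subseteq> V"
      by (elim exE)
    have "filter_base F (a ` {V\<in>\<V>. e {} \<in> V})"
      unfolding filter_base_def
    proof (intro conjI ballI)
      show "a ` {V\<in>\<V>. e {} \<in> V} \<subseteq> filter_sets F" using a by blast
      fix A assume A: "A \<in> filter_sets F"
      then obtain V where V: "V \<in> \<V>" "e {} \<in> V" "V \<subseteq> cell (e {}) A"
        using \<V>(3) openin_cell centre_in_cell e0 by meson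
      then have aV: "cell (e {}) (a V) \<subseteq> cell (e {}) A" using a by blast
      \<comment> \<open>Outside \<open>K\<close>, membership in \<open>A\<close> can be read off from the singletons in the cell of radius \<open>A\<close>.\<close>
      have "n \<in> A" if n: "n \<in> a V" for n
      proof (cases "n \<in> K")
        case True
        then show ?thesis using A by (auto simp: K_def)
      next
        case False
        have nE: "{n} \<in> E" using False by (simp add: E_def)
        have \<delta>n: "\<delta> (e {}) (e {n}) = {n}" unfolding \<delta>_def de[OF nE] de[OF \<open>{} \<in> E\<close>] by simp
        have "e {n} \<in> cell (e {}) (a V)"
          unfolding cell_def \<delta>n mem_Collect_eq using n eC[OF nE] by simp
        then have "e {n} \<in> cell (e {}) A" using aV by blast
        then show ?thesis unfolding cell_def mem_Collect_eq \<delta>n by simp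
      qed
      then show "\<exists>B\<in>a ` {V\<in>\<V>. e {} \<in> V}. B \<subseteq> A" using V by blast
    qed
    moreover have "countable (a ` {V\<in>\<V>. e {} \<in> V})" using \<V>(1) by simp
    ultimately show False using nb by blast
  qed
  moreover have "R_omega1_factorizable cell_topology"
    using cC F by (rule R_omega1_factorizable_cell_topology) simp
  ultimately show ?thesis using Tychonoff_cell_topology by blast
qed

section \<open>The equivalence\<close>

theorem theorem5p2:
  assumes "infinite (UNIV :: 'a set)" and "infinite (UNIV :: 'b set)"
  shows
    "((\<exists>F :: nat filter. A_filter F \<and> \<not> (\<exists>\<B>. countable \<B> \<and> filter_base F \<B>)) \<longleftrightarrow>
      (\<exists>X :: 'a topology. Tychonoff_space X \<and> \<not> metrizable_space X \<and> R_omega1_factorizable X)) \<and>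
     ((\<exists>X :: 'a topology. Tychonoff_space X \<and> \<not> metrizable_space X \<and> R_omega1_factorizable X) \<longleftrightarrow>
      (\<exists>(G :: 'b monoid) T. topological_group G T \<and>
         Tychonoff_space T \<and> \<not> metrizable_space T \<and> R_omega1_factorizable T))"
proof -
  let ?filter = "\<exists>F :: nat filter. A_filter F \<and> \<not> (\<exists>\<B>. countable \<B> \<and> filter_base F \<B>)"
  have space: "\<exists>X :: 'a topology. Tychonoff_space X \<and> \<not> metrizable_space X \<and> R_omega1_factorizable X"
    if ?filter
    using A_filter_imp_nonmetrizable_factorizable_group[where 'b = 'a] assms(1) that by blast
  have group: "\<exists>(G :: 'b monoid) T. topological_group G T \<and>
      Tychonoff_space T \<and> \<not> metrizable_space T \<and> R_omega1_factorizable T"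
    if ?filter
    using A_filter_imp_nonmetrizable_factorizable_group[where 'b = 'b] assms(2) that by blast
  have filter_of_space: ?filter
    if "\<exists>X :: 'a topology. Tychonoff_space X \<and> \<not> metrizable_space X \<and> R_omega1_factorizable X"
    using that nonmetrizable_factorizable_imp_A_filter by (elim exE conjE)
  have filter_of_group: ?filter
    if "\<exists>(G :: 'b monoid) T. topological_group G T \<and>
      Tychonoff_space T \<and> \<not> metrizable_space T \<and> R_omega1_factorizable T"
    using that nonmetrizable_factorizable_imp_A_filter by (elim exE conjE)
  show ?thesis
    using space group filter_of_space filter_of_group by argo
qed

end
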